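(* Let $\{\varphi_r\}_{0<r<1}$ be a regular approximate identity consisting of even functions and let $\lambda:(0,1)\to(0,\infty)$ with $\lim_{r\to1}\lambda(r)=0$ satisfy $$\Pi_\infty(\lambda,\varphi)=\limsup_{\delta\to0}\limsup_{r\to1}\int_{-\delta\lambda(r)}^{\delta\lambda(r)}\varphi_r(t)\,dt=0 .$$ Then for any $f\in L^\infty(\mathbb T)$ the relation $$\lim_{\substack{r\to1\\ y\in\lambda(r,x)}}\Phi_r(y,f)=f(x)$$ holds at any Lebesgue point $x\in\mathbb T$ of $f$.
   Context: $\mathbb T=\mathbb R/2\pi\mathbb Z$; points are represented by $t$ with $|t|\le\pi$. An approximate identity is a family $\{\varphi_r\}_{0<r<1}\subset L^\infty(\mathbb T)$ such that: ($\Phi1$) $\int_{\mathbb T}\varphi_r(t)\,dt\to1$ as $r\to1$; ($\Phi2$) $\varphi_r^*(x):=\sup_{|x|\le|t|\le\pi}|\varphi_r(t)|\to0$ as $r\to1$ for each $0<|x|\le\pi$; ($\Phi3$) $C_\varphi:=\sup_{0<r<1}\|\varphi_r^*\|_1<\infty$. It is regular if each $\varphi_r$ is non-negative, decreasing on $[0,\pi]$ and increasing on $[-\pi,0]$. In $\Pi_\infty$, $\delta\to0$ through positive values. $\Phi_r(x,f):=\int_{\mathbb T}\varphi_r(x-t)f(t)\,dt$. A point $x$ is a Lebesgue point of $f$ if $\lim_{h\to0}\frac1{2h}\int_{x-h}^{x+h}|f(u)-f(x)|\,du=0$. $\lambda(r,x)$ is the interval $[x-\lambda(r),x+\lambda(r)]\subset\mathbb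 T$ (equal to $\mathbb T$ if $\lambda(r)\ge\pi$). For a family $F_r$, $\lim_{r\to1,\ \theta\in\lambda(r,x)}F_r(\theta)=A$ means $\lim_{r\to1}\sup_{\theta\in\lambda(r,x)}|F_r(\theta)-A|=0$. *)

theory Defs
  imports "HOL-Analysis.Analysis"
begin

text \<open>
  Functions on the circle \<open>\<real>/2\<pi>\<int>\<close> are represented by \<open>2\<pi>\<close>-periodic functions on the real line,
  and integrals over the circle are taken over \<open>[-\<pi>, \<pi>]\<close>. Elements of \<open>L\<^sup>\<infinity>\<close> are actual functions
  rather than classes, since Lebesgue points and monotonicity refer to pointwise values.
\<close>

definition periodic_2pi :: "(real \<Rightarrow> 'a) \<Rightarrow> bool" where
  "periodic_2pi f \<longleftrightarrow> (\<forall>t. f (t + 2 * pi) = f t)"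

definition Linf_circle :: "(real \<Rightarrow> 'a :: real_normed_vector) set" where
  "Linf_circle = {f. periodic_2pi f \<and> f \<in> borel_measurable lebesgue \<and>
     (\<exists>C. AE t in lebesgue. norm (f t) \<le> C)}"

text \<open>
  The supremum is the pointwise one, not the essential one. It is taken in \<^typ>\<open>ennreal\<close>, so that it
  is \<open>\<infinity>\<close> (not an unspecified real) when the function is unbounded on the set.
\<close>

definition majorant :: "(real \<Rightarrow> real) \<Rightarrow> real \<Rightarrow> ennreal" where
  "majorant g x = (SUP t\<in>{t. \<bar>x\<bar> \<le> \<bar>t\<bar> \<and> \<bar>t\<bar> \<le> pi}. ennreal \<bar>g t\<bar>)"

text \<open>Families indexed by \<open>0 < r < 1\<close> are total functions; values at other \<open>r\<close> are irrelevant.\<close>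

definition approximate_identity :: "(real \<Rightarrow> real \<Rightarrow> real) \<Rightarrow> bool" where
  "approximate_identity \<phi> \<longleftrightarrow>
     (\<forall>r\<in>{0<..<1}. \<phi> r \<in> Linf_circle) \<and>
     ((\<lambda>r. LINT t:{-pi..pi}|lebesgue. \<phi> r t) \<longlongrightarrow> 1) (at_left 1) \<and>
     (\<forall>x. 0 < \<bar>x\<bar> \<and> \<bar>x\<bar> \<le> pi \<longrightarrow> ((\<lambda>r. majorant (\<phi> r) x) \<longlongrightarrow> 0) (at_left 1)) \<and>
     (SUP r\<in>{0<..<1}. \<integral>\<^sup>+x\<in>{-pi..pi}. majorant (\<phi> r) x \<partial>lebesgue) < \<infinity>"

definition regular_approximate_identity :: "(real \<Rightarrow> real \<Rightarrow> real) \<Rightarrow> bool" where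
  "regular_approximate_identity \<phi> \<longleftrightarrow>
     approximate_identity \<phi> \<and>
     (\<forall>r\<in>{0<..<1}. (\<forall>t. 0 \<le> \<phi> r t) \<and> antimono_on {0..pi} (\<phi> r) \<and> mono_on {-pi..0} (\<phi> r))"

definition Pi_infinity :: "(real \<Rightarrow> real) \<Rightarrow> (real \<Rightarrow> real \<Rightarrow> real) \<Rightarrow> ereal" where
  "Pi_infinity lam \<phi> =
     Limsup (at_right 0) (\<lambda>\<delta>. Limsup (at_left 1)
       (\<lambda>r. ereal (LINT t:{-\<delta> * lam r..\<delta> * lam r}|lebesgue. \<phi> r t)))"

text \<open>The type class constraint on the values of \<open>f\<close> covers real and complex scalars.\<close>

definition kernel_integral ::
  "(real \<Rightarrow> real \<Rightarrow> real) \<Rightarrow> real \<Rightarrow> real \<Rightarrow>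
   (real \<Rightarrow> 'a :: {real_normed_field, banach, second_countable_topology}) \<Rightarrow> 'a" where
  "kernel_integral \<phi> r x f = (LINT t:{-pi..pi}|lebesgue. of_real (\<phi> r (x - t)) * f t)"

text \<open>The quotient is an even function of \<open>h\<close>, so \<open>h \<rightarrow> 0\<close> may be restricted to \<open>h > 0\<close>.\<close>

definition lebesgue_point :: "(real \<Rightarrow> 'a :: real_normed_vector) \<Rightarrow> real \<Rightarrow> bool" where
  "lebesgue_point f x \<longleftrightarrow>
     ((\<lambda>h. 1 / (2 * h) * (LINT u:{x - h..x + h}|lebesgue. norm (f u - f x))) \<longlongrightarrow> 0) (at_right 0)"

text \<open>
  For \<open>2\<pi>\<close>-periodic \<open>F r\<close>, the supremum over the real interval \<open>[x - lam r, x + lam r]\<close> is the supremum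
  over its image in the circle, which is the whole circle once \<open>lam r \<ge> \<pi>\<close>.
\<close>

definition tendsto_along_region ::
  "(real \<Rightarrow> real) \<Rightarrow> real \<Rightarrow> (real \<Rightarrow> real \<Rightarrow> 'a :: real_normed_vector) \<Rightarrow> 'a \<Rightarrow> bool" where
  "tendsto_along_region lam x F A \<longleftrightarrow>
     ((\<lambda>r. SUP \<theta>\<in>{x - lam r..x + lam r}. ennreal (norm (F r \<theta> - A))) \<longlongrightarrow> 0) (at_left 1)"

end

theory Submission
  imports Defs
begin

text \<open>
  Write \<open>g t = norm (f t - f x)\<close>. Up to the error \<open>norm (f x) * \<bar>\<integral>\<phi>\<^sub>r - 1\<bar>\<close>, which tends to \<open>0\<close>, the
  distance from \<open>\<Phi>\<^sub>r(y, f)\<close> to \<open>f x\<close> is at most the integral of \<open>\<phi>\<^sub>r v * g (y - v)\<close> over a period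
  (lemma \<open>kernel_integral_error\<close>). Let \<open>\<bar>y - x\<bar> \<le> \<lambda>(r)\<close>, and split this integral at \<open>\<bar>v\<bar> = \<delta> \<lambda>(r)\<close> and
  at a small fixed \<open>\<bar>v\<bar> = \<eta>\<close>.

  On the core \<open>\<bar>v\<bar> \<le> \<delta> \<lambda>(r)\<close> the Lebesgue point says nothing, because \<open>y\<close> may be displaced
  from \<open>x\<close> by much more than the length of the core; but \<open>g\<close> is bounded and \<open>\<Pi>\<^sub>\<infinity> = 0\<close> says that the kernel puts little
  mass there once \<open>\<delta>\<close> is small. On the tail \<open>\<bar>v\<bar> \<ge> \<eta>\<close> the kernel is at most \<open>\<phi>\<^sub>r \<eta>\<close>, which tends to
  \<open>0\<close>. In between, the displacement is at most a constant multiple of the distance: for \<open>h \<ge> \<delta> \<lambda>(r)\<close> the interval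
  \<open>[y - h, y + h]\<close> lies in the interval of radius \<open>h + \<lambda>(r) \<le> (1 + 1/\<delta>) h\<close> about \<open>x\<close>, so the mean of \<open>g\<close>
  over \<open>[y - h, y + h]\<close> is at most \<open>(1 + 1/\<delta>) \<epsilon>\<close> when the means of \<open>g\<close> about \<open>x\<close> are at most \<open>\<epsilon>\<close>.
  An even decreasing kernel is a superposition of indicators of intervals \<open>[-h, h]\<close>, so a bound for
  the means passes to a bound for the kernel integral (lemma \<open>nn_integral_even_decreasing_le\<close>).
  The number \<open>\<delta>\<close> is chosen before \<open>\<epsilon>\<close>, hence \<open>(1 + 1/\<delta>) \<epsilon>\<close> can be made small. Lemma
  \<open>kernel_average_bound\<close> collects the three estimates for a single kernel; none depends on \<open>y\<close>.

  The three ranges are estimated with integrals in \<^typ>\<open>ennreal\<close>, so that only measurability has to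
  be known of the products and restrictions that occur.
\<close>

section \<open>Weighted integrals from bounds on superlevel sets\<close>

lemma sigma_finite_lebesgue: "sigma_finite_measure (lebesgue :: 'a::euclidean_space measure)"
proof -
  obtain A :: "'a set set" where "countable A" "A \<subseteq> sets lborel" "\<Union>A = space lborel"
    "\<forall>a\<in>A. emeasure lborel a \<noteq> \<infinity>"
    using sigma_finite_lborel[where 'a='a] by (auto simp: sigma_finite_measure_def)
  then show ?thesis
    by unfold_locales (auto intro!: exI[of _ A])
qed

lemma ident_borel_measurable_lebesgue [measurable]:
  "(\<lambda>t. t) \<in> borel_measurable (lebesgue :: 'a::euclidean_space measure)"
  by (rule measurable_completion) simp

text \<open>
  Tonelli's theorem for the region below the graph of \<open>\<psi>\<close>, where \<open>\<psi> v\<close> is the length of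
  \<open>{0..<\<psi> v}\<close>. Negative values of \<open>\<psi>\<close> contribute \<open>0\<close> to both sides.
\<close>

lemma nn_integral_layer_cake:
  fixes \<psi> :: "'a \<Rightarrow> real" and w :: "'a \<Rightarrow> ennreal"
  assumes "sigma_finite_measure M"
    and [measurable]: "\<psi> \<in> borel_measurable M" "w \<in> borel_measurable M"
  shows "(\<integral>\<^sup>+v. ennreal (\<psi> v) * w v \<partial>M)
       = (\<integral>\<^sup>+\<tau>. indicator {0..} \<tau> * (\<integral>\<^sup>+v. indicator {v. \<tau> < \<psi> v} v * w v \<partial>M) \<partial>lborel)"
proof -
  interpret M: sigma_finite_measure M by fact
  interpret pair_sigma_finite M lborel ..
  have eq: "ennreal (\<psi> v) = (\<integral>\<^sup>+\<tau>. indicator {0..<\<psi> v} \<tau> \<partial>lborel)" for v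
    by (cases "0 \<le> \<psi> v") (auto simp: ennreal_neg)
  have "(\<integral>\<^sup>+v. ennreal (\<psi> v) * w v \<partial>M)
      = (\<integral>\<^sup>+v. (\<integral>\<^sup>+\<tau>. indicator {0..} \<tau> * indicator {v. \<tau> < \<psi> v} v * w v \<partial>lborel) \<partial>M)"
    unfolding eq
    by (intro nn_integral_cong, subst nn_integral_multc[symmetric])
       (auto intro!: nn_integral_cong simp: indicator_def)
  also have "\<dots> = (\<integral>\<^sup>+\<tau>. (\<integral>\<^sup>+v. indicator {0..} \<tau> * indicator {v. \<tau> < \<psi> v} v * w v \<partial>M) \<partial>lborel)"
    by (rule Fubini'[symmetric]) (simp add: indicator_def[abs_def])
  also have "\<dots> = (\<integral>\<^sup>+\<tau>. indicator {0..} \<tau> * (\<integral>\<^sup>+v. indicator {v. \<tau> < \<psi> v} v * w v \<partial>M) \<partial>lborel)"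
    by (intro nn_integral_cong, subst nn_integral_cmult[symmetric])
       (auto simp: mult.assoc indicator_def[abs_def])
  finally show ?thesis .
qed

text \<open>
  Integrating the hypothesis over \<open>\<tau>\<close> gives the conclusion, by the layer-cake formula for the
  weights \<open>w\<close> and \<open>1\<close>.
\<close>

lemma nn_integral_weight_le_of_superlevel_sets:
  fixes \<psi> :: "'a \<Rightarrow> real" and w :: "'a \<Rightarrow> ennreal"
  assumes M: "sigma_finite_measure M"
    and [measurable]: "\<psi> \<in> borel_measurable M" "w \<in> borel_measurable M"
    and le: "\<And>\<tau>. 0 \<le> \<tau> \<Longrightarrow> (\<integral>\<^sup>+v. indicator {v. \<tau> < \<psi> v} v * w v \<partial>M)
                     \<le> K * (\<integral>\<^sup>+v. indicator {v. \<tau> < \<psi> v} v \<partial>M)"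
  shows "(\<integral>\<^sup>+v. ennreal (\<psi> v) * w v \<partial>M) \<le> K * (\<integral>\<^sup>+v. ennreal (\<psi> v) \<partial>M)"
proof -
  interpret M: sigma_finite_measure M by fact
  have [measurable]: "(\<lambda>\<tau>. \<integral>\<^sup>+v. indicator {v. \<tau> < \<psi> v} v * 1 \<partial>M) \<in> borel_measurable borel"
    by (rule M.borel_measurable_nn_integral) (simp add: indicator_def[abs_def])
  have "(\<integral>\<^sup>+v. ennreal (\<psi> v) * w v \<partial>M)
      \<le> (\<integral>\<^sup>+\<tau>. K * (indicator {0..} \<tau> * (\<integral>\<^sup>+v. indicator {v. \<tau> < \<psi> v} v * 1 \<partial>M)) \<partial>lborel)"
    unfolding nn_integral_layer_cake[OF M \<open>\<psi> \<in> _\<close> \<open>w \<in> _\<close>]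
    by (intro nn_integral_mono) (use le in \<open>auto simp: indicator_def\<close>)
  also have "\<dots> = K * (\<integral>\<^sup>+v. ennreal (\<psi> v) * 1 \<partial>M)"
    unfolding nn_integral_layer_cake[OF M \<open>\<psi> \<in> _\<close> borel_measurable_const]
    by (rule nn_integral_cmult) measurable
  finally show ?thesis by simp
qed

text \<open>
  Only intervals of radius at least \<open>a\<close> have controlled means of \<open>w\<close>. For this reason \<open>\<phi>\<close> is flattened
  to the constant \<open>\<phi> a\<close> on \<open>[-a, a]\<close> and set to \<open>0\<close> beyond \<open>\<eta>\<close>: each nonempty superlevel set of the
  result at a level \<open>\<tau> \<ge> 0\<close> is, up to end points, an interval \<open>[-h, h]\<close> with \<open>a \<le> h \<le> \<eta>\<close>.
\<close>

lemma nn_integral_even_decreasing_le: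
  fixes \<phi> :: "real \<Rightarrow> real" and w :: "real \<Rightarrow> ennreal"
  assumes [measurable]: "\<phi> \<in> borel_measurable lebesgue" "w \<in> borel_measurable lebesgue"
    and nonneg: "\<And>t. 0 \<le> \<phi> t" and even: "\<And>t. \<phi> (- t) = \<phi> t"
    and anti: "antimono_on {0..\<eta>} \<phi>" and a: "0 < a" "a \<le> \<eta>"
    and avg: "\<And>h. a \<le> h \<Longrightarrow> h \<le> \<eta> \<Longrightarrow> (\<integral>\<^sup>+v\<in>{-h..h}. w v \<partial>lebesgue) \<le> K * ennreal (2 * h)"
  shows "(\<integral>\<^sup>+v\<in>{v. a \<le> \<bar>v\<bar> \<and> \<bar>v\<bar> \<le> \<eta>}. (ennreal (\<phi> v) * w v) \<partial>lebesgue)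
       \<le> K * (\<integral>\<^sup>+v\<in>{-\<eta>..\<eta>}. ennreal (\<phi> v) \<partial>lebesgue)"
proof -
  have abs: "\<phi> \<bar>t\<bar> = \<phi> t" for t
    using even by (auto simp: abs_if)
  have dec: "\<phi> t \<le> \<phi> s" if "\<bar>s\<bar> \<le> \<bar>t\<bar>" "\<bar>t\<bar> \<le> \<eta>" for s t
    using monotone_onD[OF anti, of "\<bar>s\<bar>" "\<bar>t\<bar>"] that abs by auto
  define \<psi> where "\<psi> v = indicator {-\<eta>..\<eta>} v * min (\<phi> v) (\<phi> a)" for v
  have [measurable]: "\<psi> \<in> borel_measurable lebesgue"
    unfolding \<psi>_def by measurable
  have "(\<integral>\<^sup>+v\<in>{v. a \<le> \<bar>v\<bar> \<and> \<bar>v\<bar> \<le> \<eta>}. (ennreal (\<phi> v) * w v) \<partial>lebesgue)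
     \<le> (\<integral>\<^sup>+v. ennreal (\<psi> v) * w v \<partial>lebesgue)"
  proof (rule nn_integral_mono)
    fix v
    have "\<psi> v = \<phi> v" if "a \<le> \<bar>v\<bar>" "\<bar>v\<bar> \<le> \<eta>"
      using dec[of a v] that a by (auto simp: \<psi>_def indicator_def abs_le_iff)
    then show "ennreal (\<phi> v) * w v * indicator {v. a \<le> \<bar>v\<bar> \<and> \<bar>v\<bar> \<le> \<eta>} v \<le> ennreal (\<psi> v) * w v"
      by (auto simp: indicator_def)
  qed
  also have "\<dots> \<le> K * (\<integral>\<^sup>+v. ennreal (\<psi> v) \<partial>lebesgue)"
  proof (rule nn_integral_weight_le_of_superlevel_sets[OF sigma_finite_lebesgue])
    fix \<tau> :: real assume "0 \<le> \<tau>"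
    let ?S = "{v. \<tau> < \<psi> v}"
    show "(\<integral>\<^sup>+v. indicator ?S v * w v \<partial>lebesgue) \<le> K * (\<integral>\<^sup>+v. indicator ?S v \<partial>lebesgue)"
    proof (cases "\<tau> < \<phi> a")
      case False
      then have "?S = {}" using \<open>0 \<le> \<tau>\<close> by (auto simp: \<psi>_def indicator_def)
      then show ?thesis by simp
    next
      case True
      have S: "v \<in> ?S \<longleftrightarrow> \<bar>v\<bar> \<le> \<eta> \<and> \<tau> < \<phi> v" for v
        using True \<open>0 \<le> \<tau>\<close> by (auto simp: \<psi>_def indicator_def abs_le_iff)
      define h where "h = Sup ?S"
      have bdd: "bdd_above ?S"
      proof (rule bdd_aboveI[of _ \<eta>])
        fix v assume "v \<in> ?S"
        then show "v \<le> \<eta>" unfolding S by auto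
      qed
      have aS: "a \<in> ?S" using True a S by auto
      have h: "a \<le> h" "h \<le> \<eta>"
      proof -
        show "a \<le> h" unfolding h_def by (rule cSup_upper[OF aS bdd])
        show "h \<le> \<eta>" unfolding h_def
        proof (rule cSup_least)
          fix v assume "v \<in> ?S"
          then show "v \<le> \<eta>" unfolding S by auto
        qed (use aS in blast)
      qed
      have sub: "?S \<subseteq> {-h..h}"
      proof
        fix v assume "v \<in> ?S"
        then have "v \<in> ?S" "- v \<in> ?S" unfolding S even by auto
        then show "v \<in> {-h..h}" using cSup_upper[OF _ bdd] unfolding h_def by force
      qed
      have sup: "{-h<..<h} \<subseteq> ?S"
      proof
        fix v assume "v \<in> {-h<..<h}"
        then have "\<bar>v\<bar> < Sup ?S" by (auto simp: h_def)
        then obtain u where u: "u \<in> ?S" "\<bar>v\<bar> < u"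
          using less_cSup_iff[of ?S "\<bar>v\<bar>"] aS bdd by blast
        then show "v \<in> ?S" using dec[of v u] unfolding S by auto
      qed
      have "(\<integral>\<^sup>+v. indicator ?S v * w v \<partial>lebesgue) \<le> (\<integral>\<^sup>+v\<in>{-h..h}. w v \<partial>lebesgue)"
        using sub by (intro nn_integral_mono) (auto simp: indicator_def)
      also have "\<dots> \<le> K * ennreal (2 * h)" by (rule avg[OF h])
      also have "ennreal (2 * h) = (\<integral>\<^sup>+v. indicator {-h<..<h} v \<partial>lebesgue)"
        using h a by simp
      also have "\<dots> \<le> (\<integral>\<^sup>+v. indicator ?S v \<partial>lebesgue)"
        using sup by (intro nn_integral_mono) (auto simp: indicator_def)
      finally show ?thesis by (simp add: mult_left_mono)
    qed
  qed measurable
  also have "\<dots> \<le> K * (\<integral>\<^sup>+v\<in>{-\<eta>..\<eta>}. ennreal (\<phi> v) \<partial>lebesgue)"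
    by (intro mult_left_mono nn_integral_mono) (auto simp: \<psi>_def indicator_def intro!: ennreal_leI)
  finally show ?thesis .
qed

section \<open>Translations and reflections on the circle\<close>

lemma periodic_2pi_int:
  assumes "periodic_2pi f"
  shows "f (t + of_int k * (2 * pi)) = f t"
proof -
  have nat: "f (t + real n * (2 * pi)) = f t" for n t
  proof (induction n)
    case (Suc n)
    have "f (t + real (Suc n) * (2 * pi)) = f ((t + real n * (2 * pi)) + 2 * pi)"
      by (simp add: algebra_simps)
    then show ?case using assms Suc by (simp add: periodic_2pi_def)
  qed simp
  show ?thesis
  proof (cases "0 \<le> k")
    case True
    then show ?thesis using nat[of t "nat k"] by simp
  next
    case False
    then show ?thesis using nat[of "t + of_int k * (2 * pi)" "nat (- k)"] by simp
  qed
qed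

lemma set_nn_integral_lebesgue_shift:
  fixes f :: "real \<Rightarrow> ennreal"
  assumes [measurable]: "f \<in> borel_measurable lebesgue"
  shows "(\<integral>\<^sup>+t\<in>{a + c..b + c}. f t \<partial>lebesgue) = (\<integral>\<^sup>+t\<in>{a..b}. f (t + c) \<partial>lebesgue)"
proof -
  have m: "(\<lambda>t. f t * indicator {a + c..b + c} t) \<in> borel_measurable lebesgue"
    by measurable
  have "(\<integral>\<^sup>+t\<in>{a + c..b + c}. f t \<partial>lebesgue)
      = (\<integral>\<^sup>+t. f (c + 1 * t) * indicator {a + c..b + c} (c + 1 * t) \<partial>lebesgue)"
    using nn_integral_real_affine_lebesgue[OF m, of 1 c] by simp
  also have "\<dots> = (\<integral>\<^sup>+t\<in>{a..b}. f (t + c) \<partial>lebesgue)"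
    by (auto simp: add.commute indicator_def intro!: nn_integral_cong)
  finally show ?thesis .
qed

lemma set_nn_integral_lebesgue_reflect:
  fixes f :: "real \<Rightarrow> ennreal"
  assumes [measurable]: "f \<in> borel_measurable lebesgue"
  shows "(\<integral>\<^sup>+t\<in>{c - b..c - a}. f t \<partial>lebesgue) = (\<integral>\<^sup>+v\<in>{a..b}. f (c - v) \<partial>lebesgue)"
proof -
  have m: "(\<lambda>t. f t * indicator {c - b..c - a} t) \<in> borel_measurable lebesgue"
    by measurable
  have "(\<integral>\<^sup>+t\<in>{c - b..c - a}. f t \<partial>lebesgue)
      = (\<integral>\<^sup>+v. f (c + - 1 * v) * indicator {c - b..c - a} (c + - 1 * v) \<partial>lebesgue)"
    using nn_integral_real_affine_lebesgue[OF m, of "- 1" c] by simp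
  also have "\<dots> = (\<integral>\<^sup>+v\<in>{a..b}. f (c - v) \<partial>lebesgue)"
    by (auto simp: indicator_def intro!: nn_integral_cong)
  finally show ?thesis .
qed

lemma set_nn_integral_Icc_combine:
  fixes f :: "real \<Rightarrow> ennreal"
  assumes [measurable]: "f \<in> borel_measurable lebesgue" and "a \<le> b" "b \<le> c"
  shows "(\<integral>\<^sup>+t\<in>{a..c}. f t \<partial>lebesgue) = (\<integral>\<^sup>+t\<in>{a..b}. f t \<partial>lebesgue) + (\<integral>\<^sup>+t\<in>{b..c}. f t \<partial>lebesgue)"
proof -
  have ne: "AE t in lebesgue. t \<noteq> b"
    by (rule AE_I[of _ _ "{b}"]) auto
  have "(\<integral>\<^sup>+t\<in>{a..c}. f t \<partial>lebesgue)
      = (\<integral>\<^sup>+t. f t * indicator {a..b} t + f t * indicator {b..c} t \<partial>lebesgue)"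
    by (rule nn_integral_cong_AE, use ne in eventually_elim)
       (use assms(2,3) in \<open>auto simp: indicator_def\<close>)
  also have "\<dots> = (\<integral>\<^sup>+t\<in>{a..b}. f t \<partial>lebesgue) + (\<integral>\<^sup>+t\<in>{b..c}. f t \<partial>lebesgue)"
    by (rule nn_integral_add) measurable
  finally show ?thesis .
qed

lemma set_nn_integral_period:
  fixes f :: "real \<Rightarrow> ennreal"
  assumes [measurable]: "f \<in> borel_measurable lebesgue" and per: "periodic_2pi f"
  shows "(\<integral>\<^sup>+t\<in>{c..c + 2 * pi}. f t \<partial>lebesgue) = (\<integral>\<^sup>+t\<in>{-pi..pi}. f t \<partial>lebesgue)"
proof -
  \<comment> \<open>After a shift by whole periods the left end point lies in \<open>[-\<pi>, \<pi>]\<close>; then the part that sticks out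
    to the right of \<open>\<pi>\<close> is moved back by one period.\<close>
  define k where "k = \<lfloor>(c + pi) / (2 * pi)\<rfloor>"
  define b where "b = c - of_int k * (2 * pi)"
  have "of_int k \<le> (c + pi) / (2 * pi)" "(c + pi) / (2 * pi) \<le> of_int k + 1"
    unfolding k_def by linarith+
  then have "of_int k * (2 * pi) \<le> c + pi" "c + pi \<le> (of_int k + 1) * (2 * pi)"
    using pi_gt_zero by (simp_all add: pos_le_divide_eq pos_divide_le_eq)
  then have b: "-pi \<le> b" "b \<le> pi" by (auto simp: b_def algebra_simps)
  have "(\<integral>\<^sup>+t\<in>{c..c + 2 * pi}. f t \<partial>lebesgue) = (\<integral>\<^sup>+t\<in>{b..b + 2 * pi}. f t \<partial>lebesgue)"
    using set_nn_integral_lebesgue_shift[of f b "of_int k * (2 * pi)" "b + 2 * pi"]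
    by (simp add: periodic_2pi_int[OF per] b_def add_ac)
  also have "\<dots> = (\<integral>\<^sup>+t\<in>{b..pi}. f t \<partial>lebesgue) + (\<integral>\<^sup>+t\<in>{pi..b + 2 * pi}. f t \<partial>lebesgue)"
    using b by (intro set_nn_integral_Icc_combine) auto
  also have "(\<integral>\<^sup>+t\<in>{pi..b + 2 * pi}. f t \<partial>lebesgue) = (\<integral>\<^sup>+t\<in>{-pi..b}. f t \<partial>lebesgue)"
    using set_nn_integral_lebesgue_shift[of f "-pi" "2 * pi" b] per by (simp add: periodic_2pi_def)
  also have "(\<integral>\<^sup>+t\<in>{b..pi}. f t \<partial>lebesgue) + (\<integral>\<^sup>+t\<in>{-pi..b}. f t \<partial>lebesgue)
      = (\<integral>\<^sup>+t\<in>{-pi..pi}. f t \<partial>lebesgue)"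
    using b by (subst set_nn_integral_Icc_combine[of f "-pi" b pi]) (auto simp: add.commute)
  finally show ?thesis .
qed

text \<open>Reflections preserve Lebesgue measure, hence null sets.\<close>

lemma AE_lebesgue_reflect:
  assumes "AE t in lebesgue. P t"
  shows "AE v in lebesgue. P (c - v :: real)"
proof -
  have eq: "lebesgue = distr lebesgue lebesgue (\<lambda>v. c - v)"
    using lebesgue_real_affine[of "-1" c] by (simp add: density_1)
  have m: "(\<lambda>v. c - v) \<in> lebesgue \<rightarrow>\<^sub>M lebesgue"
    using lebesgue_affine_measurable[of "\<lambda>_. -1" c] by simp
  show ?thesis using assms by (subst (asm) eq) (rule AE_distrD[OF m])
qed

section \<open>The estimate for a single kernel\<close>

text \<open>
  The three terms bound the core \<open>\<bar>v\<bar> \<le> \<delta> l\<close>, the middle range and the tail \<open>\<bar>v\<bar> \<ge> \<eta>\<close>. The condition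
  \<open>\<eta> + l \<le> \<rho>\<close> makes the intervals about \<open>x\<close> that cover those about \<open>y\<close> short enough for the hypothesis
  on the means.
\<close>

lemma kernel_average_bound:
  fixes \<phi> :: "real \<Rightarrow> real" and g :: "real \<Rightarrow> ennreal"
  assumes [measurable]: "\<phi> \<in> borel_measurable lebesgue" "g \<in> borel_measurable lebesgue"
    and nonneg: "\<And>t. 0 \<le> \<phi> t" and even: "\<And>t. \<phi> (- t) = \<phi> t"
    and anti: "antimono_on {0..pi} \<phi>"
    and bound: "AE t in lebesgue. g t \<le> ennreal M"
    and avg: "\<And>h. 0 < h \<Longrightarrow> h \<le> \<rho> \<Longrightarrow> (\<integral>\<^sup>+t\<in>{x - h..x + h}. g t \<partial>lebesgue) \<le> ennreal (2 * h * \<epsilon>)"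
    and y: "\<bar>y - x\<bar> \<le> l" and l: "0 < l" and \<delta>: "0 < \<delta>" "\<delta> * l \<le> \<eta>" and \<eta>: "\<eta> \<le> pi" "\<eta> + l \<le> \<rho>"
    and "0 \<le> M" "0 \<le> \<epsilon>"
  shows "(\<integral>\<^sup>+v\<in>{-pi..pi}. (ennreal (\<phi> v) * g (y - v)) \<partial>lebesgue)
     \<le> ennreal M * (\<integral>\<^sup>+v\<in>{-(\<delta> * l)..\<delta> * l}. ennreal (\<phi> v) \<partial>lebesgue)
       + ennreal ((1 + 1 / \<delta>) * \<epsilon>) * (\<integral>\<^sup>+v\<in>{-pi..pi}. ennreal (\<phi> v) \<partial>lebesgue)
       + ennreal (M * \<phi> \<eta> * (2 * pi))"
proof -
  define a where "a = \<delta> * l"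
  have a: "0 < a" "a \<le> \<eta>" using l \<delta> by (auto simp: a_def)
  define w where "w v = g (y - v)" for v
  have m: "(\<lambda>v. y - v) \<in> lebesgue \<rightarrow>\<^sub>M lebesgue"
    using lebesgue_affine_measurable[of "\<lambda>_. -1" y] by simp
  have [measurable]: "w \<in> borel_measurable lebesgue"
    unfolding w_def using measurable_compose[OF m \<open>g \<in> _\<close>] .
  have wM: "AE v in lebesgue. w v \<le> ennreal M"
    unfolding w_def by (rule AE_lebesgue_reflect[OF bound])
  have abs: "\<phi> \<bar>t\<bar> = \<phi> t" for t
    using even by (auto simp: abs_if)
  let ?I = "\<lambda>S. \<integral>\<^sup>+v\<in>S. (ennreal (\<phi> v) * w v) \<partial>lebesgue"
  have near: "?I {-a..a} \<le> ennreal M * (\<integral>\<^sup>+v\<in>{-a..a}. ennreal (\<phi> v) \<partial>lebesgue)"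
  proof -
    have "?I {-a..a} \<le> (\<integral>\<^sup>+v. ennreal M * (ennreal (\<phi> v) * indicator {-a..a} v) \<partial>lebesgue)"
      by (rule nn_integral_mono_AE, use wM in eventually_elim)
         (auto simp: indicator_def mult.commute mult_right_mono)
    then show ?thesis by (subst (asm) nn_integral_cmult) measurable
  qed
  have far: "?I {v. \<eta> \<le> \<bar>v\<bar> \<and> \<bar>v\<bar> \<le> pi} \<le> ennreal (M * \<phi> \<eta> * (2 * pi))"
  proof -
    have "?I {v. \<eta> \<le> \<bar>v\<bar> \<and> \<bar>v\<bar> \<le> pi} \<le> (\<integral>\<^sup>+v. ennreal (M * \<phi> \<eta>) * indicator {-pi..pi} v \<partial>lebesgue)"
    proof (rule nn_integral_mono_AE, use wM in eventually_elim)
      fix v assume v: "w v \<le> ennreal M"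
      show "ennreal (\<phi> v) * w v * indicator {v. \<eta> \<le> \<bar>v\<bar> \<and> \<bar>v\<bar> \<le> pi} v
          \<le> ennreal (M * \<phi> \<eta>) * indicator {-pi..pi} v"
      proof (cases "\<eta> \<le> \<bar>v\<bar> \<and> \<bar>v\<bar> \<le> pi")
        case True
        then have "\<phi> v \<le> \<phi> \<eta>"
          using monotone_onD[OF anti, of \<eta> "\<bar>v\<bar>"] a abs by auto
        then have "ennreal (\<phi> v) * w v \<le> ennreal (\<phi> \<eta>) * ennreal M"
          using v by (intro mult_mono ennreal_leI) auto
        then show ?thesis
          using True nonneg \<open>0 \<le> M\<close> by (auto simp: indicator_def abs_le_iff ennreal_mult mult.commute)
      qed simp
    qed
    also have "\<dots> = ennreal (M * \<phi> \<eta> * (2 * pi))"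
      using nonneg \<open>0 \<le> M\<close> by (subst nn_integral_cmult_indicator) (auto simp: ennreal_mult)
    finally show ?thesis .
  qed
  have middle: "?I {v. a \<le> \<bar>v\<bar> \<and> \<bar>v\<bar> \<le> \<eta>}
      \<le> ennreal ((1 + 1 / \<delta>) * \<epsilon>) * (\<integral>\<^sup>+v\<in>{-\<eta>..\<eta>}. ennreal (\<phi> v) \<partial>lebesgue)"
  proof (rule nn_integral_even_decreasing_le
        [where a = a and \<eta> = \<eta> and \<phi> = \<phi> and w = w,
          OF \<open>\<phi> \<in> _\<close> \<open>w \<in> _\<close> nonneg even _ a])
    show "antimono_on {0..\<eta>} \<phi>"
      by (rule monotone_on_subset[OF anti]) (use \<eta> in auto)
    fix h assume h: "a \<le> h" "h \<le> \<eta>"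
    have "(\<integral>\<^sup>+v\<in>{-h..h}. w v \<partial>lebesgue) = (\<integral>\<^sup>+t\<in>{y - h..y - (-h)}. g t \<partial>lebesgue)"
      unfolding w_def by (rule set_nn_integral_lebesgue_reflect[symmetric]) measurable
    also have "\<dots> \<le> (\<integral>\<^sup>+t\<in>{x - (h + l)..x + (h + l)}. g t \<partial>lebesgue)"
      using y by (intro nn_set_integral_set_mono) auto
    also have "\<dots> \<le> ennreal (2 * (h + l) * \<epsilon>)"
      using h a l \<eta> by (intro avg) auto
    also have "\<dots> \<le> ennreal ((1 + 1 / \<delta>) * \<epsilon> * (2 * h))"
    proof (rule ennreal_leI)
      \<comment> \<open>This is where \<open>h \<ge> \<delta> l\<close> controls the displacement of \<open>y\<close> from \<open>x\<close>.\<close>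
      have "l \<le> h / \<delta>" using h \<delta> by (simp add: a_def field_simps)
      then have "(h + l) * (2 * \<epsilon>) \<le> (h + h / \<delta>) * (2 * \<epsilon>)"
        using \<open>0 \<le> \<epsilon>\<close> by (intro mult_right_mono) auto
      then show "2 * (h + l) * \<epsilon> \<le> (1 + 1 / \<delta>) * \<epsilon> * (2 * h)" by (simp add: algebra_simps)
    qed
    also have "\<dots> = ennreal ((1 + 1 / \<delta>) * \<epsilon>) * ennreal (2 * h)"
      using h a \<delta> \<open>0 \<le> \<epsilon>\<close> by (intro ennreal_mult) auto
    finally show "(\<integral>\<^sup>+v\<in>{-h..h}. w v \<partial>lebesgue) \<le> ennreal ((1 + 1 / \<delta>) * \<epsilon>) * ennreal (2 * h)" .
  qed
  have [measurable]: "{v. s \<le> \<bar>v\<bar> \<and> \<bar>v\<bar> \<le> t} \<in> sets lebesgue" for s t :: real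
  proof -
    have "{v. s \<le> \<bar>v\<bar> \<and> \<bar>v\<bar> \<le> t} = {-t..t} - {-s<..<s}" by auto
    then show ?thesis by simp
  qed
  have "?I {-pi..pi} \<le> (\<integral>\<^sup>+v. ennreal (\<phi> v) * w v * indicator {-a..a} v
        + ennreal (\<phi> v) * w v * indicator {v. a \<le> \<bar>v\<bar> \<and> \<bar>v\<bar> \<le> \<eta>} v
        + ennreal (\<phi> v) * w v * indicator {v. \<eta> \<le> \<bar>v\<bar> \<and> \<bar>v\<bar> \<le> pi} v \<partial>lebesgue)"
    by (rule nn_integral_mono) (auto simp: indicator_def)
  also have "\<dots> = ?I {-a..a} + ?I {v. a \<le> \<bar>v\<bar> \<and> \<bar>v\<bar> \<le> \<eta>} + ?I {v. \<eta> \<le> \<bar>v\<bar> \<and> \<bar>v\<bar> \<le> pi}"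
    by (simp add: nn_integral_add)
  also have "\<dots> \<le> ennreal M * (\<integral>\<^sup>+v\<in>{-a..a}. ennreal (\<phi> v) \<partial>lebesgue)
       + ennreal ((1 + 1 / \<delta>) * \<epsilon>) * (\<integral>\<^sup>+v\<in>{-\<eta>..\<eta>}. ennreal (\<phi> v) \<partial>lebesgue)
       + ennreal (M * \<phi> \<eta> * (2 * pi))"
    by (intro add_mono near middle far)
  also have "\<dots> \<le> ennreal M * (\<integral>\<^sup>+v\<in>{-a..a}. ennreal (\<phi> v) \<partial>lebesgue)
       + ennreal ((1 + 1 / \<delta>) * \<epsilon>) * (\<integral>\<^sup>+v\<in>{-pi..pi}. ennreal (\<phi> v) \<partial>lebesgue)
       + ennreal (M * \<phi> \<eta> * (2 * pi))"
    using \<eta> by (intro add_mono mult_left_mono nn_set_integral_set_mono) auto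
  finally show ?thesis by (simp add: w_def a_def)
qed

section \<open>Bounded functions on the circle and the kernel integral\<close>

lemma Linf_circle_reflect:
  assumes "f \<in> Linf_circle"
  shows "(\<lambda>t. f (y - t)) \<in> Linf_circle"
proof -
  obtain C where C: "AE t in lebesgue. norm (f t) \<le> C"
    and per: "periodic_2pi f" and m: "f \<in> borel_measurable lebesgue"
    using assms by (auto simp: Linf_circle_def)
  have "f (y - (t + 2 * pi)) = f (y - t)" for t
    using periodic_2pi_int[OF per, of "y - t" "-1"] by (simp add: algebra_simps)
  moreover have "(\<lambda>t. y - t) \<in> lebesgue \<rightarrow>\<^sub>M lebesgue"
    using lebesgue_affine_measurable[of "\<lambda>_. -1" y] by simp
  ultimately show ?thesis
    using AE_lebesgue_reflect[OF C] measurable_compose[OF _ m]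
    by (auto simp: Linf_circle_def periodic_2pi_def)
qed

lemma Linf_circle_const: "(\<lambda>_. c) \<in> Linf_circle"
  by (auto simp: Linf_circle_def periodic_2pi_def)

lemma Linf_circle_scaleR:
  fixes f :: "real \<Rightarrow> 'a :: {real_normed_vector, second_countable_topology}"
  assumes "\<psi> \<in> Linf_circle" "f \<in> Linf_circle"
  shows "(\<lambda>t. \<psi> t *\<^sub>R f t) \<in> Linf_circle"
proof -
  obtain B C where "AE t in lebesgue. norm (\<psi> t) \<le> B" "AE t in lebesgue. norm (f t) \<le> C"
    using assms by (auto simp: Linf_circle_def)
  then have "AE t in lebesgue. norm (\<psi> t *\<^sub>R f t) \<le> \<bar>B\<bar> * \<bar>C\<bar>"
    by eventually_elim (auto intro!: mult_mono)
  then show ?thesis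
    using assms by (auto simp: Linf_circle_def periodic_2pi_def intro!: borel_measurable_scaleR)
qed

lemma Linf_circle_diff:
  fixes f :: "real \<Rightarrow> 'a :: {real_normed_vector, second_countable_topology}"
  assumes "f \<in> Linf_circle" "g \<in> Linf_circle"
  shows "(\<lambda>t. f t - g t) \<in> Linf_circle"
proof -
  obtain B C where "AE t in lebesgue. norm (f t) \<le> B" "AE t in lebesgue. norm (g t) \<le> C"
    using assms by (auto simp: Linf_circle_def)
  then have "AE t in lebesgue. norm (f t - g t) \<le> B + C"
    by eventually_elim (rule order_trans[OF norm_triangle_ineq4 add_mono])
  then show ?thesis
    using assms by (auto simp: Linf_circle_def periodic_2pi_def intro!: borel_measurable_diff)
qed

lemma Linf_circle_norm:
  "f \<in> Linf_circle \<Longrightarrow> (\<lambda>t. norm (f t)) \<in> Linf_circle"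
  by (auto simp: Linf_circle_def periodic_2pi_def)

lemma Linf_circle_set_integrable:
  fixes f :: "real \<Rightarrow> 'a :: {banach, second_countable_topology}"
  assumes "f \<in> Linf_circle"
  shows "set_integrable lebesgue {a..b} f"
proof -
  obtain C where "AE t in lebesgue. norm (f t) \<le> C"
    using assms by (auto simp: Linf_circle_def)
  then show ?thesis
    unfolding set_integrable_def using assms
    by (intro integrableI_bounded_set_indicator[where B = C])
       (auto simp: Linf_circle_def emeasure_lborel_Icc_eq)
qed

lemma nn_integral_eq_set_integral_Linf_circle:
  fixes \<psi> :: "real \<Rightarrow> real"
  assumes "\<psi> \<in> Linf_circle" "\<And>t. 0 \<le> \<psi> t"
  shows "(\<integral>\<^sup>+t\<in>{a..b}. ennreal (\<psi> t) \<partial>lebesgue) = ennreal (LINT t:{a..b}|lebesgue. \<psi> t)"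
proof -
  have "(\<integral>\<^sup>+t\<in>{a..b}. ennreal (\<psi> t) \<partial>lebesgue)
      = (\<integral>\<^sup>+t. ennreal (indicator {a..b} t *\<^sub>R \<psi> t) \<partial>lebesgue)"
    by (intro nn_integral_cong) (auto simp: indicator_def)
  also have "\<dots> = ennreal (LINT t:{a..b}|lebesgue. \<psi> t)"
    unfolding set_lebesgue_integral_def
    by (intro nn_integral_eq_integral)
       (use Linf_circle_set_integrable[OF assms(1)] assms(2) in \<open>auto simp: set_integrable_def\<close>)
  finally show ?thesis .
qed

lemma nn_integral_circle_reflect:
  fixes g :: "real \<Rightarrow> ennreal"
  assumes [measurable]: "g \<in> borel_measurable lebesgue" and "periodic_2pi g"
  shows "(\<integral>\<^sup>+t\<in>{-pi..pi}. g (y - t) \<partial>lebesgue) = (\<integral>\<^sup>+v\<in>{-pi..pi}. g v \<partial>lebesgue)"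
  using set_nn_integral_lebesgue_reflect[of g y pi "-pi"]
    set_nn_integral_period[OF assms, of "y - pi"] by (simp add: add.commute)

text \<open>
  The constant \<open>c\<close> is reproduced by the kernel up to the defect of the total mass from \<open>1\<close>. Periodicity
  turns the integral over \<open>t\<close> into one over \<open>v = y - t\<close>, which centres the kernel at \<open>0\<close>.
\<close>

lemma kernel_integral_error:
  fixes f :: "real \<Rightarrow> 'a :: {real_normed_field, banach, second_countable_topology}"
  assumes \<phi>: "\<phi> r \<in> Linf_circle" and nonneg: "\<And>t. 0 \<le> \<phi> r t" and f: "f \<in> Linf_circle"
  shows "ennreal (norm (kernel_integral \<phi> r y f - c))
    \<le> (\<integral>\<^sup>+v\<in>{-pi..pi}. (ennreal (\<phi> r v) * ennreal (norm (f (y - v) - c))) \<partial>lebesgue)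
      + ennreal (norm c * \<bar>(LINT t:{-pi..pi}|lebesgue. \<phi> r t) - 1\<bar>)"
proof -
  let ?\<psi> = "\<lambda>t. \<phi> r (y - t)"
  let ?D = "\<lambda>t. ?\<psi> t *\<^sub>R (f t - c)"
  have \<psi>: "?\<psi> \<in> Linf_circle" by (rule Linf_circle_reflect[OF \<phi>])
  have D: "?D \<in> Linf_circle"
    by (intro Linf_circle_scaleR \<psi> Linf_circle_diff f Linf_circle_const)
  have C: "(\<lambda>t. ?\<psi> t *\<^sub>R c) \<in> Linf_circle"
    by (intro Linf_circle_scaleR \<psi> Linf_circle_const)
  have mass: "(LINT t:{-pi..pi}|lebesgue. ?\<psi> t) = (LINT t:{-pi..pi}|lebesgue. \<phi> r t)"
  proof -
    have [measurable]: "\<phi> r \<in> borel_measurable lebesgue"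
      using \<phi> by (simp add: Linf_circle_def)
    have "(\<lambda>t. ennreal (\<phi> r t)) \<in> borel_measurable lebesgue" by measurable
    then have "ennreal (LINT t:{-pi..pi}|lebesgue. ?\<psi> t) = ennreal (LINT t:{-pi..pi}|lebesgue. \<phi> r t)"
      using nn_integral_circle_reflect[of "\<lambda>t. ennreal (\<phi> r t)" y] \<phi>
      by (simp flip: nn_integral_eq_set_integral_Linf_circle[OF \<psi> nonneg]
            nn_integral_eq_set_integral_Linf_circle[OF \<phi> nonneg]
          add: Linf_circle_def periodic_2pi_def)
    then show ?thesis
      by (subst (asm) ennreal_inj)
         (auto simp: set_lebesgue_integral_def nonneg intro!: integral_nonneg_AE)
  qed
  have "kernel_integral \<phi> r y f = (LINT t:{-pi..pi}|lebesgue. ?D t + ?\<psi> t *\<^sub>R c)"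
    unfolding kernel_integral_def by (simp add: scaleR_conv_of_real algebra_simps)
  also have "\<dots> = (LINT t:{-pi..pi}|lebesgue. ?D t) + (LINT t:{-pi..pi}|lebesgue. ?\<psi> t *\<^sub>R c)"
    by (intro set_integral_add Linf_circle_set_integrable D C)
  also have "(LINT t:{-pi..pi}|lebesgue. ?\<psi> t *\<^sub>R c) = (LINT t:{-pi..pi}|lebesgue. \<phi> r t) *\<^sub>R c"
  proof -
    have "(LINT t:{-pi..pi}|lebesgue. ?\<psi> t *\<^sub>R c) = (LINT t:{-pi..pi}|lebesgue. ?\<psi> t) *\<^sub>R c"
      unfolding set_lebesgue_integral_def scaleR_scaleR[symmetric, of _ "?\<psi> _"]
      using Linf_circle_set_integrable[OF \<psi>, of "-pi" pi]
      by (subst integral_scaleR_left[symmetric]) (auto simp: set_integrable_def)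
    then show ?thesis by (simp add: mass)
  qed
  finally have "kernel_integral \<phi> r y f - c
      = (LINT t:{-pi..pi}|lebesgue. ?D t) + ((LINT t:{-pi..pi}|lebesgue. \<phi> r t) - 1) *\<^sub>R c"
    by (simp add: algebra_simps)
  then have "norm (kernel_integral \<phi> r y f - c) \<le> norm (LINT t:{-pi..pi}|lebesgue. ?D t)
      + norm c * \<bar>(LINT t:{-pi..pi}|lebesgue. \<phi> r t) - 1\<bar>"
    using norm_triangle_ineq[of "LINT t:{-pi..pi}|lebesgue. ?D t"
        "((LINT t:{-pi..pi}|lebesgue. \<phi> r t) - 1) *\<^sub>R c"] by (simp add: mult.commute)
  then have "ennreal (norm (kernel_integral \<phi> r y f - c))
      \<le> ennreal (norm (LINT t:{-pi..pi}|lebesgue. ?D t))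
        + ennreal (norm c * \<bar>(LINT t:{-pi..pi}|lebesgue. \<phi> r t) - 1\<bar>)"
    by (rule order_trans[OF ennreal_leI eq_refl[OF ennreal_plus]]) simp_all
  also have "ennreal (norm (LINT t:{-pi..pi}|lebesgue. ?D t))
      \<le> (\<integral>\<^sup>+v\<in>{-pi..pi}. (ennreal (\<phi> r v) * ennreal (norm (f (y - v) - c))) \<partial>lebesgue)"
  proof -
    let ?h = "\<lambda>v. ennreal (\<phi> r v) * ennreal (norm (f (y - v) - c))"
    have "ennreal (norm (LINT t:{-pi..pi}|lebesgue. ?D t))
        \<le> (\<integral>\<^sup>+t. norm (indicator {-pi..pi} t *\<^sub>R ?D t) \<partial>lebesgue)"
      unfolding set_lebesgue_integral_def
      using Linf_circle_set_integrable[OF D, of "-pi" pi]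
      by (intro integral_norm_bound_ennreal) (simp add: set_integrable_def)
    also have "\<dots> = (\<integral>\<^sup>+t\<in>{-pi..pi}. ?h (y - t) \<partial>lebesgue)"
      using nonneg by (intro nn_integral_cong) (auto simp: indicator_def ennreal_mult)
    also have "\<dots> = (\<integral>\<^sup>+v\<in>{-pi..pi}. ?h v \<partial>lebesgue)"
      using \<phi> Linf_circle_norm[OF Linf_circle_diff[OF Linf_circle_reflect[OF f] Linf_circle_const], of y c]
      by (intro nn_integral_circle_reflect) (auto simp: Linf_circle_def periodic_2pi_def)
    finally show ?thesis .
  qed
  finally show ?thesis by (simp add: add_right_mono)
qed

lemma lebesgue_point_nn_integral_le:
  fixes f :: "real \<Rightarrow> 'a :: {real_normed_vector, second_countable_topology}"
  assumes f: "f \<in> Linf_circle" and x: "lebesgue_point f x" and "0 < \<epsilon>"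
  obtains \<rho> where "0 < \<rho>"
    "\<And>h. 0 < h \<Longrightarrow> h \<le> \<rho> \<Longrightarrow>
      (\<integral>\<^sup>+t\<in>{x - h..x + h}. ennreal (norm (f t - f x)) \<partial>lebesgue) \<le> ennreal (2 * h * \<epsilon>)"
proof -
  have g: "(\<lambda>t. norm (f t - f x)) \<in> Linf_circle"
    by (intro Linf_circle_norm Linf_circle_diff f Linf_circle_const)
  have "\<forall>\<^sub>F h in at_right 0. 1 / (2 * h) * (LINT u:{x - h..x + h}|lebesgue. norm (f u - f x)) < \<epsilon>"
    using x \<open>0 < \<epsilon>\<close> unfolding lebesgue_point_def by (rule order_tendstoD(2))
  then obtain b where b: "0 < b"
    "\<And>h. 0 < h \<Longrightarrow> h < b \<Longrightarrow> 1 / (2 * h) * (LINT u:{x - h..x + h}|lebesgue. norm (f u - f x)) < \<epsilon>"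
    unfolding eventually_at_right_field by auto
  show ?thesis
  proof (rule that[of "b / 2"])
    fix h assume h: "0 < h" "h \<le> b / 2"
    then have "(LINT u:{x - h..x + h}|lebesgue. norm (f u - f x)) \<le> 2 * h * \<epsilon>"
      using b(2)[of h] \<open>0 < b\<close> by (simp add: field_simps)
    then show "(\<integral>\<^sup>+t\<in>{x - h..x + h}. ennreal (norm (f t - f x)) \<partial>lebesgue) \<le> ennreal (2 * h * \<epsilon>)"
      by (subst nn_integral_eq_set_integral_Linf_circle[OF g]) (auto intro: ennreal_leI)
  qed (use b in auto)
qed

section \<open>Convergence at Lebesgue points\<close>

theorem theorem1p5:
  fixes \<phi> :: "real \<Rightarrow> real \<Rightarrow> real"
    and lam :: "real \<Rightarrow> real"
    and f :: "real \<Rightarrow> 'a :: {real_normed_field, banach, second_countable_topology}"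
    and x :: real
  assumes "regular_approximate_identity \<phi>"
    and "\<And>r t. r \<in> {0<..<1} \<Longrightarrow> \<phi> r (-t) = \<phi> r t"
    and "\<And>r. r \<in> {0<..<1} \<Longrightarrow> 0 < lam r"
    and "(lam \<longlongrightarrow> 0) (at_left 1)"
    and "Pi_infinity lam \<phi> = 0"
    and "f \<in> Linf_circle"
    and "lebesgue_point f x"
  shows "tendsto_along_region lam x (\<lambda>r y. kernel_integral \<phi> r y f) (f x)"
  unfolding tendsto_along_region_def
proof (rule tendsto_zero_ennreal)
  fix e :: real assume "0 < e"
  have Linf: "\<phi> r \<in> Linf_circle" and nonneg: "0 \<le> \<phi> r t" and anti: "antimono_on {0..pi} (\<phi> r)"
    if "r \<in> {0<..<1}" for r t
    using assms(1) that by (auto simp: regular_approximate_identity_def approximate_identity_def)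
  have mass: "((\<lambda>r. LINT t:{-pi..pi}|lebesgue. \<phi> r t) \<longlongrightarrow> 1) (at_left 1)"
    and maj: "\<And>x. 0 < \<bar>x\<bar> \<Longrightarrow> \<bar>x\<bar> \<le> pi \<Longrightarrow> ((\<lambda>r. majorant (\<phi> r) x) \<longlongrightarrow> 0) (at_left 1)"
    using assms(1) by (auto simp: regular_approximate_identity_def approximate_identity_def)
  obtain M where "0 \<le> M" and M: "AE t in lebesgue. ennreal (norm (f t - f x)) \<le> ennreal M"
  proof -
    have "(\<lambda>t. f t - f x) \<in> Linf_circle"
      by (intro Linf_circle_diff assms(6) Linf_circle_const)
    then obtain C where "AE t in lebesgue. norm (f t - f x) \<le> C"
      by (auto simp: Linf_circle_def)
    then have "AE t in lebesgue. ennreal (norm (f t - f x)) \<le> ennreal \<bar>C\<bar>"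
      by eventually_elim (auto intro: ennreal_leI)
    then show ?thesis using that[of "\<bar>C\<bar>"] by auto
  qed
  \<comment> \<open>Each of four error terms is at most \<open>e / 8\<close>, so that the sum is at most \<open>e / 2\<close> and the supremum
    over \<open>\<theta>\<close> stays strictly below \<open>e\<close>. The \<open>1\<close> in \<open>M + 1\<close> only avoids division by zero.\<close>
  define \<kappa> where "\<kappa> = e / (8 * (M + 1))"
  have share: "n * (e / (8 * (n + 1))) \<le> e / 8" if "0 \<le> n" for n
    using \<open>0 < e\<close> that by (simp add: field_simps)
  have "0 < \<kappa>" using \<open>0 < e\<close> \<open>0 \<le> M\<close> by (simp add: \<kappa>_def)
  have "\<forall>\<^sub>F \<delta> in at_right 0. Limsup (at_left 1)
      (\<lambda>r. ereal (LINT t:{-\<delta> * lam r..\<delta> * lam r}|lebesgue. \<phi> r t)) < ereal \<kappa>"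
    using assms(5) \<open>0 < \<kappa>\<close> unfolding Pi_infinity_def by (intro Limsup_lessD) simp
  then have "\<forall>\<^sub>F \<delta> in at_right 0. 0 < \<delta> \<and> Limsup (at_left 1)
      (\<lambda>r. ereal (LINT t:{-\<delta> * lam r..\<delta> * lam r}|lebesgue. \<phi> r t)) < ereal \<kappa>"
    by (intro eventually_conj eventually_at_right_less)
  then obtain \<delta> where "0 < \<delta>" and "Limsup (at_left 1)
      (\<lambda>r. ereal (LINT t:{-\<delta> * lam r..\<delta> * lam r}|lebesgue. \<phi> r t)) < ereal \<kappa>"
    using eventually_happens'[OF trivial_limit_at_right_real] by blast
  then have core: "\<forall>\<^sub>F r in at_left 1. (LINT t:{-\<delta> * lam r..\<delta> * lam r}|lebesgue. \<phi> r t) < \<kappa>"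
    by (drule_tac Limsup_lessD) simp
  \<comment> \<open>The extra factor \<open>2\<close> bounds the total mass of the kernel for \<open>r\<close> near \<open>1\<close>.\<close>
  define \<epsilon> where "\<epsilon> = e / (16 * (1 + 1 / \<delta>))"
  have "0 < \<epsilon>" using \<open>0 < e\<close> \<open>0 < \<delta>\<close> by (simp add: \<epsilon>_def add_pos_pos)
  obtain \<rho> where "0 < \<rho>" and avg: "\<And>h. 0 < h \<Longrightarrow> h \<le> \<rho> \<Longrightarrow>
      (\<integral>\<^sup>+t\<in>{x - h..x + h}. ennreal (norm (f t - f x)) \<partial>lebesgue) \<le> ennreal (2 * h * \<epsilon>)"
    by (rule lebesgue_point_nn_integral_le[OF assms(6,7) \<open>0 < \<epsilon>\<close>]) blast
  define \<eta> where "\<eta> = min (\<rho> / 2) pi"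
  have \<eta>: "0 < \<eta>" "\<eta> \<le> pi" "\<eta> \<le> \<rho> / 2" using \<open>0 < \<rho>\<close> by (auto simp: \<eta>_def)
  have "0 < \<kappa> / (2 * pi)" using \<open>0 < \<kappa>\<close> by simp
  have tail: "\<forall>\<^sub>F r in at_left 1. majorant (\<phi> r) \<eta> < ennreal (\<kappa> / (2 * pi))"
    using maj[of \<eta>] \<eta> \<open>0 < \<kappa> / (2 * pi)\<close> by (intro order_tendstoD(2)) auto
  have "0 < min (\<rho> / 2) (\<eta> / \<delta>)" using \<open>0 < \<rho>\<close> \<open>0 < \<delta>\<close> \<eta> by auto
  then have lam_small: "\<forall>\<^sub>F r in at_left 1. lam r < min (\<rho> / 2) (\<eta> / \<delta>)"
    by (rule order_tendstoD(2)[OF assms(4)])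
  define \<mu> where "\<mu> = min 1 (e / (8 * (norm (f x) + 1)))"
  have "0 < \<mu>" using \<open>0 < e\<close> by (auto simp: \<mu>_def add_nonneg_pos)
  then have mass_close: "\<forall>\<^sub>F r in at_left 1. \<bar>(LINT t:{-pi..pi}|lebesgue. \<phi> r t) - 1\<bar> < \<mu>"
    using tendstoD[OF mass] by (simp add: dist_real_def)
  have unit: "\<forall>\<^sub>F r in at_left 1. r \<in> {0<..<1::real}"
    by (rule eventually_at_leftI[of 0]) auto
  show "\<forall>\<^sub>F r in at_left 1. (SUP \<theta>\<in>{x - lam r..x + lam r}.
      ennreal (norm (kernel_integral \<phi> r \<theta> f - f x))) < ennreal e"
    using core tail lam_small mass_close unit
  proof eventually_elim
    case (elim r)
    let ?m = "\<lambda>a. LINT t:{-a..a}|lebesgue. \<phi> r t"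
    note nn = nn_integral_eq_set_integral_Linf_circle[OF Linf nonneg, OF elim(5) elim(5)]
    have "ennreal (norm (kernel_integral \<phi> r y f - f x)) \<le> ennreal (e / 2)"
      if y: "y \<in> {x - lam r..x + lam r}" for y
    proof -
      have 1: "M * ?m (\<delta> * lam r) \<le> e / 8"
      proof -
        have "M * ?m (\<delta> * lam r) \<le> M * \<kappa>"
          using elim(1) \<open>0 \<le> M\<close> by (intro mult_left_mono) auto
        also have "\<dots> \<le> e / 8" unfolding \<kappa>_def using \<open>0 \<le> M\<close> by (rule share)
        finally show ?thesis .
      qed
      have 2: "(1 + 1 / \<delta>) * \<epsilon> * ?m pi \<le> e / 8"
      proof -
        have "?m pi \<le> 2" using elim(4) by (auto simp: \<mu>_def)
        then have "(1 + 1 / \<delta>) * \<epsilon> * ?m pi \<le> (1 + 1 / \<delta>) * \<epsilon> * 2"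
          using \<open>0 < \<delta>\<close> \<open>0 < \<epsilon>\<close> by (intro mult_left_mono) auto
        also have "\<dots> = e / 8"
        proof -
          have "c * (e / (16 * c)) * 2 = e / 8" if "0 < c" for c :: real
            using that by simp
          then show ?thesis unfolding \<epsilon>_def using \<open>0 < \<delta>\<close> by (simp only: add_pos_pos zero_less_one zero_less_divide_1_iff)
        qed
        finally show ?thesis .
      qed
      have 3: "M * \<phi> r \<eta> * (2 * pi) \<le> e / 8"
      proof -
        have "ennreal \<bar>\<phi> r \<eta>\<bar> \<le> majorant (\<phi> r) \<eta>"
          unfolding majorant_def by (rule SUP_upper) (use \<eta> in auto)
        then have "ennreal \<bar>\<phi> r \<eta>\<bar> < ennreal (\<kappa> / (2 * pi))"
          using elim(2) by (rule le_less_trans)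
        then have "\<phi> r \<eta> * (2 * pi) \<le> \<kappa>"
          using nonneg[OF elim(5), of \<eta>]
          by (simp add: ennreal_less_iff pos_less_divide_eq)
        then have "M * (\<phi> r \<eta> * (2 * pi)) \<le> M * \<kappa>"
          using \<open>0 \<le> M\<close> by (rule mult_left_mono)
        also have "\<dots> \<le> e / 8" unfolding \<kappa>_def using \<open>0 \<le> M\<close> by (rule share)
        finally show ?thesis by (simp add: mult.assoc)
      qed
      have 4: "norm (f x) * \<bar>?m pi - 1\<bar> \<le> e / 8"
      proof -
        have "norm (f x) * \<bar>?m pi - 1\<bar> \<le> norm (f x) * (e / (8 * (norm (f x) + 1)))"
          using elim(4) by (intro mult_left_mono) (auto simp: \<mu>_def)
        also have "\<dots> \<le> e / 8"
          by (rule share) simp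
        finally show ?thesis .
      qed
      have pos: "0 \<le> ?m a" for a
        unfolding set_lebesgue_integral_def by (intro integral_nonneg_AE) (auto simp: nonneg[OF elim(5)])
      have "ennreal (norm (kernel_integral \<phi> r y f - f x))
        \<le> (\<integral>\<^sup>+v\<in>{-pi..pi}. (ennreal (\<phi> r v) * ennreal (norm (f (y - v) - f x))) \<partial>lebesgue)
          + ennreal (norm (f x) * \<bar>?m pi - 1\<bar>)"
        by (rule kernel_integral_error) (fact Linf[OF elim(5)] nonneg[OF elim(5)] assms(6))+
      also have "(\<integral>\<^sup>+v\<in>{-pi..pi}. (ennreal (\<phi> r v) * ennreal (norm (f (y - v) - f x))) \<partial>lebesgue)
        \<le> ennreal M * (\<integral>\<^sup>+v\<in>{-(\<delta> * lam r)..\<delta> * lam r}. ennreal (\<phi> r v) \<partial>lebesgue)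
          + ennreal ((1 + 1 / \<delta>) * \<epsilon>) * (\<integral>\<^sup>+v\<in>{-pi..pi}. ennreal (\<phi> r v) \<partial>lebesgue)
          + ennreal (M * \<phi> r \<eta> * (2 * pi))"
      proof (rule kernel_average_bound[where \<rho> = \<rho> and x = x])
        show "\<phi> r \<in> borel_measurable lebesgue" "(\<lambda>t. ennreal (norm (f t - f x))) \<in> borel_measurable lebesgue"
          using Linf[OF elim(5)] assms(6) by (auto simp: Linf_circle_def)
        show "\<delta> * lam r \<le> \<eta>" using elim(3) \<open>0 < \<delta>\<close> by (simp add: field_simps)
        show "\<bar>y - x\<bar> \<le> lam r" using y by auto
      qed (use elim nonneg anti assms(2,3) M avg \<eta> \<open>0 < \<delta>\<close> \<open>0 \<le> M\<close> \<open>0 < \<epsilon>\<close> in auto)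
      also have "\<dots> = ennreal (M * ?m (\<delta> * lam r) + (1 + 1 / \<delta>) * \<epsilon> * ?m pi + M * \<phi> r \<eta> * (2 * pi))"
        using pos \<open>0 \<le> M\<close> \<open>0 < \<delta>\<close> \<open>0 < \<epsilon>\<close> nonneg[OF elim(5)]
        by (simp add: nn ennreal_mult ennreal_plus)
      also have "\<dots> + ennreal (norm (f x) * \<bar>?m pi - 1\<bar>)
        = ennreal (M * ?m (\<delta> * lam r) + (1 + 1 / \<delta>) * \<epsilon> * ?m pi + M * \<phi> r \<eta> * (2 * pi)
            + norm (f x) * \<bar>?m pi - 1\<bar>)"
        using pos \<open>0 \<le> M\<close> \<open>0 < \<delta>\<close> \<open>0 < \<epsilon>\<close> nonneg[OF elim(5)]
        by (intro ennreal_plus[symmetric]) auto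
      also have "\<dots> \<le> ennreal (e / 2)"
        using add_mono[OF add_mono[OF add_mono[OF 1 2] 3] 4] by (intro ennreal_leI) simp
      finally show ?thesis by (simp add: add_right_mono)
    qed
    then have "(SUP \<theta>\<in>{x - lam r..x + lam r}. ennreal (norm (kernel_integral \<phi> r \<theta> f - f x)))
        \<le> ennreal (e / 2)"
      by (rule SUP_least)
    also have "\<dots> < ennreal e" using \<open>0 < e\<close> by (simp add: ennreal_less_iff)
    finally show ?case .
  qed
qed

end
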